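(* Let $m\ge 4$ be an integer and let $\mathcal{U}=\{S_0, S_{2,1^0}, S_{2,1^1},\ldots,S_{2,1^{m-1}}\}$. Let $$Q=\left\{\mathbf{y}=(y_0,\ldots,y_m)\in\mathbb{R}^{m+1} \;\middle|\; \begin{array}{l} -y_1+y_2\ge 0,\\ 4y_1-3y_2\ge 0,\\ 3y_1-3y_3+y_4\ge 0,\\ y_1+2y_{m-1}-2y_m\ge 0,\\ y_0+y_{m-1}-y_m\ge 0,\\ y_0-2y_1+y_3\ge 0,\\ y_{i-1}-2y_i+y_{i+1}\ge 0 \quad\text{for all } 2\le i\le m-1,\\ m\,y_{m-1}-(m-1)\,y_m\ge 0 \end{array}\right\}.$$ Then $\operatorname{trop}(\mathcal{N}_{\mathcal{U}})=Q$.
   Context: All graphs are finite. For graphs $H,G$, $\hom(H;G)$ is the number of maps $V(H)\to V(G)$ sending every edge of $H$ to an edge of $G$. $S_0$ is the graph with a single vertex and no edges. For $k\ge 0$, $S_{2,1^k}$ is the tree with vertex set $\{1,\ldots,k+3\}$ and edge set $\{\{1,j\}: 2\le j\le k+2\}\cup\{\{k+2,k+3\}\}$ (a star with $k+1$ branches, one of which is lengthened to two edges). For a collection $\mathcal{U}=\{H_1,\ldots,H_s\}$ of connected graphs, the number graph profile $\mathcal{N}_{\mathcal{U}}\subseteq\mathbb{N}^s$ is the set of all vectors $(\hom(H_1;G),\ldots,\hom(H_s;G))$ as $G$ ranges over all graphs. For $\mathcal{S}\subseteq\mathbb{R}^s_{\ge 0}$, let $\log(\mathcal{S})=\{(\log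 v_1,\ldots,\log v_s): \mathbf{v}\in \mathcal{S}\cap\mathbb{R}^s_{>0}\}$, and the tropicalization (logarithmic limit set) is $\operatorname{trop}(\mathcal{S})=\lim_{\tau\to\infty}\log_\tau(\mathcal{S})$; for $\mathcal{N}_{\mathcal{U}}$ this equals the closure of the conical hull of $\log(\mathcal{N}_{\mathcal{U}})$. Coordinates are ordered so that $y_0$ corresponds to $S_0$ and $y_i$ corresponds to $S_{2,1^{i-1}}$ for $1\le i\le m$. *)

theory Defs
  imports "HOL-Analysis.Analysis" "HOL-Library.FuncSet"
begin

text \<open>Finite simple graphs with natural-number vertices (every finite graph is
isomorphic to one of these): a vertex set and a symmetric, irreflexive edge
relation on it, given as a set of ordered pairs.\<close>

type_synonym graph = "nat set \<times> (nat \<times> nat) set"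

definition verts :: "graph \<Rightarrow> nat set" where "verts G = fst G"
definition edges :: "graph \<Rightarrow> (nat \<times> nat) set" where "edges G = snd G"

definition is_graph :: "graph \<Rightarrow> bool" where
  "is_graph G \<longleftrightarrow> finite (verts G) \<and> edges G \<subseteq> verts G \<times> verts G
     \<and> (\<forall>u v. (u, v) \<in> edges G \<longrightarrow> (v, u) \<in> edges G)
     \<and> (\<forall>u. (u, u) \<notin> edges G)"

definition hom :: "graph \<Rightarrow> graph \<Rightarrow> nat" where
  "hom H G = card {f \<in> verts H \<rightarrow>\<^sub>E verts G.
                     \<forall>u v. (u, v) \<in> edges H \<longrightarrow> (f u, f v) \<in> edges G}"

definition S0 :: graph where "S0 = ({0}, {})"

definition S21 :: "nat \<Rightarrow> graph" where
  "S21 k = ({1..k+3},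
     {(1, j) | j. 2 \<le> j \<and> j \<le> k+2} \<union> {(j, 1) | j. 2 \<le> j \<and> j \<le> k+2}
     \<union> {(k+2, k+3), (k+3, k+2)})"

definition Ugraph :: "nat \<Rightarrow> graph" where
  "Ugraph i = (if i = 0 then S0 else S21 (i - 1))"

text \<open>Vectors in R^{m+1} are represented as functions nat \<Rightarrow> real with coordinates
0..m, vanishing outside {0..m}.\<close>

definition log_profile :: "nat \<Rightarrow> (nat \<Rightarrow> real) set" where
  "log_profile m = {(\<lambda>i. if i \<le> m then ln (real (hom (Ugraph i) G)) else 0) | G.
                      is_graph G \<and> (\<forall>i\<le>m. 0 < hom (Ugraph i) G)}"

definition conic_comb :: "(nat \<Rightarrow> real) set \<Rightarrow> (nat \<Rightarrow> real) set" where
  "conic_comb S = {(\<lambda>i. \<Sum>j<n. c j * x j i) | (n::nat) (c::nat \<Rightarrow> real) (x::nat \<Rightarrow> nat \<Rightarrow> real).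
                     (\<forall>j<n. 0 \<le> c j \<and> x j \<in> S)}"

definition closure_m :: "nat \<Rightarrow> (nat \<Rightarrow> real) set \<Rightarrow> (nat \<Rightarrow> real) set" where
  "closure_m m S = {y. (\<forall>i>m. y i = 0) \<and>
                       (\<forall>e>0. \<exists>z\<in>S. \<forall>i\<le>m. \<bar>y i - z i\<bar> < e)}"

definition trop_profile :: "nat \<Rightarrow> (nat \<Rightarrow> real) set" where
  "trop_profile m = closure_m m (conic_comb (log_profile m))"

definition Qset :: "nat \<Rightarrow> (nat \<Rightarrow> real) set" where
  "Qset m = {y. (\<forall>i>m. y i = 0)
      \<and> - y 1 + y 2 \<ge> 0
      \<and> 4 * y 1 - 3 * y 2 \<ge> 0
      \<and> 3 * y 1 - 3 * y 3 + y 4 \<ge> 0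
      \<and> y 1 + 2 * y (m-1) - 2 * y m \<ge> 0
      \<and> y 0 + y (m-1) - y m \<ge> 0
      \<and> y 0 - 2 * y 1 + y 3 \<ge> 0
      \<and> (\<forall>i. 2 \<le> i \<and> i \<le> m - 1 \<longrightarrow> y (i-1) - 2 * y i + y (i+1) \<ge> 0)
      \<and> real m * y (m-1) - real (m-1) * y m \<ge> 0}"

end

theory Submission
  imports Defs
begin

text \<open>
  Write $d_v$ for degrees, $w_v = \sum_{u \sim v} d_u$ and $a_k = \sum_v d_v^k w_v$, the number of
  homomorphisms from $S_{2,1^k}$. The inequalities of $Q$ follow from weighted Cauchy--Schwarz
  together with $w_v^2 \le d_v a_0$, and from bounds on the maximum degree.

  Conversely, disjoint union adds profiles, so tropically it takes coordinatewise maxima. Hence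
  $y \in Q$ lies in the tropicalization as soon as for every coordinate $i$ there are graphs whose
  growth exponents are at most $y$ everywhere and equal to $y_i$ at $i$. The sequence
  $y_1, \dots, y_m$ is convex, and a single family of graphs realizes exponents lying on a tangent
  line of it: disjoint copies of a set of hubs joined completely to a disjoint union of equal
  cliques.
\<close>

subsection \<open>Homomorphism counts\<close>

definition deg :: "(nat \<times> nat) set \<Rightarrow> nat \<Rightarrow> nat" where
  "deg E v = card (E `` {v})"

text \<open>An ordered edge \<open>(u, v)\<close> records the images of the centre and of the middle
  vertex of the long branch. The \<open>k\<close> leaves then choose neighbours of \<open>u\<close>,
  and the end of the long branch a neighbour of \<open>v\<close>.\<close>

definition broom_sum :: "(nat \<times> nat) set \<Rightarrow> nat \<Rightarrow> nat" where
  "broom_sum E k = (\<Sum>(u, v)\<in>E. deg E u ^ k * deg E v)"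

lemma is_graphD:
  assumes "is_graph G"
  shows "finite (verts G)" "finite (edges G)" "edges G \<subseteq> verts G \<times> verts G" "sym (edges G)"
    "finite (edges G `` A)"
proof -
  show 1: "finite (verts G)" "edges G \<subseteq> verts G \<times> verts G" "sym (edges G)"
    using assms by (auto simp: is_graph_def sym_def)
  then show 2: "finite (edges G)"
    by (meson finite_SigmaI finite_subset)
  then show "finite (edges G `` A)"
    by (rule finite_Image)
qed

lemma hom_S0: "hom S0 G = card (verts G)"
proof -
  have "hom S0 G = card ({0::nat} \<rightarrow>\<^sub>E verts G)"
    by (simp add: hom_def S0_def verts_def edges_def)
  then show ?thesis
    by (simp add: card_PiE)
qed

text \<open>Homomorphisms are grouped by the images of the vertices \<open>1\<close> and
  \<open>k+2\<close>; within one group the other vertices choose independently, so each group is a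
  product set.\<close>

lemma hom_S21:
  assumes G: "is_graph G"
  shows "hom (S21 k) G = broom_sum (edges G) k"
proof -
  let ?E = "edges G" and ?V = "verts G"
  note g = is_graphD[OF G]
  \<comment> \<open>\<open>R (v, u) j\<close> is the set of images allowed for vertex
    \<open>j\<close> once \<open>1\<close> goes to \<open>v\<close> and \<open>k+2\<close> to
    \<open>u\<close>.\<close>
  define R where "R = (\<lambda>(v, u) j. if j = 1 then {v} else if j \<le> k + 1 then ?E `` {v}
      else if j = k + 2 then {u} else ?E `` {u})"
  let ?H = "\<lambda>e. PiE {1..k+3} (R e)"
  have split: "{1..k+3} = insert 1 (insert (k+2) (insert (k+3) {2..k+1}))"
    by auto
  have fin: "finite (?H e)" for e
    by (rule finite_PiE) (auto simp: R_def g split: prod.split)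
  have card_H: "card (?H e) = (case e of (v, u) \<Rightarrow> deg ?E v ^ k * deg ?E u)" for e
  proof (cases e)
    case (Pair v u)
    have "card (?H e) = (\<Prod>j\<in>{1..k+3}. card (R e j))"
      by (rule card_PiE) simp
    also have "\<dots> = card (?E `` {u}) * (\<Prod>j\<in>{2..k+1}. card (R e j))"
      unfolding split by (simp add: Pair R_def)
    also have "(\<Prod>j\<in>{2..k+1}. card (R e j)) = (\<Prod>j\<in>{2..k+1}. card (?E `` {v}))"
      by (rule prod.cong) (auto simp: Pair R_def)
    finally show ?thesis
      by (simp add: Pair deg_def)
  qed
  have disj: "?H e \<inter> ?H e' = {}" if "e \<noteq> e'" for e e'
  proof (rule ccontr)
    assume "?H e \<inter> ?H e' \<noteq> {}"
    then obtain f where f: "f \<in> ?H e" "f \<in> ?H e'" by blast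
    have "f 1 \<in> R e 1" "f 1 \<in> R e' 1" "f (k+2) \<in> R e (k+2)" "f (k+2) \<in> R e' (k+2)"
      using PiE_mem[OF f(1)] PiE_mem[OF f(2)] by auto
    then show False
      using that by (auto simp: R_def split: prod.splits)
  qed
  have "{f \<in> verts (S21 k) \<rightarrow>\<^sub>E ?V. \<forall>u v. (u, v) \<in> edges (S21 k) \<longrightarrow> (f u, f v) \<in> ?E}
      = (\<Union>e\<in>?E. ?H e)" (is "?L = ?R")
  proof (intro equalityI subsetI)
    fix f assume f: "f \<in> ?L"
    have e: "(f a, f b) \<in> ?E" if "(a, b) \<in> edges (S21 k)" for a b
      using f that by blast
    have 1: "(f 1, f j) \<in> ?E" if "2 \<le> j" "j \<le> k + 2" for j
      using e[of 1 j] that by (simp add: S21_def edges_def)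
    have 2: "(f (k+2), f (k+3)) \<in> ?E"
      using e[of "k+2" "k+3"] by (simp add: S21_def edges_def)
    have "f \<in> ?H (f 1, f (k+2))"
    proof (rule PiE_I)
      fix j assume j: "j \<in> {1..k+3}"
      consider "j = 1" | "2 \<le> j" "j \<le> k + 1" | "j = k + 2" | "j = k + 3"
        using j by force
      then show "f j \<in> R (f 1, f (k+2)) j"
        using 1[of j] 2 by cases (auto simp: R_def)
    next
      fix j assume "j \<notin> {1..k+3}"
      with f show "f j = undefined"
        by (auto simp: S21_def verts_def PiE_def extensional_def)
    qed
    with 1[of "k+2"] show "f \<in> ?R" by (intro UN_I[of "(f 1, f (k+2))"]) auto
  next
    fix f assume "f \<in> ?R"
    then obtain v u where vu: "(v, u) \<in> ?E" and f: "f \<in> ?H (v, u)" by auto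
    have m: "f j \<in> R (v, u) j" if "1 \<le> j" "j \<le> k + 3" for j
      using PiE_mem[OF f] that by auto
    have f1: "f 1 = v" and f2: "f (k+2) = u" and f3: "(u, f (k+3)) \<in> ?E"
      using m[of 1] m[of "k+2"] m[of "k+3"] by (auto simp: R_def)
    have 1: "(v, f j) \<in> ?E" if "2 \<le> j" "j \<le> k + 2" for j
      using m[of j] that vu f2 by (cases "j = k + 2") (auto simp: R_def)
    have "f j \<in> ?V" if j: "1 \<le> j" "j \<le> k + 3" for j
    proof -
      consider "j = 1" | "2 \<le> j" "j \<le> k + 2" | "j = k + 3"
        using j by linarith
      then show ?thesis
        using f1 vu 1[of j] f3 g(3) by cases auto
    qed
    moreover have "f \<in> extensional {1..k+3}"
      using f by (auto simp: PiE_def)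
    moreover have "(f a, f b) \<in> ?E" if "(a, b) \<in> edges (S21 k)" for a b
      using that f1 f2 f3 1 g(4) unfolding S21_def edges_def by (auto dest: symD)
    ultimately show "f \<in> ?L"
      by (auto simp: S21_def verts_def PiE_def)
  qed
  then have "hom (S21 k) G = card (\<Union>e\<in>?E. ?H e)"
    by (simp add: hom_def)
  also have "\<dots> = (\<Sum>e\<in>?E. card (?H e))"
    by (rule card_UN_disjoint) (use g fin disj in auto)
  finally show ?thesis
    by (simp only: card_H broom_sum_def)
qed

lemma hom_Ugraph:
  assumes "is_graph G"
  shows "hom (Ugraph 0) G = card (verts G)" "hom (Ugraph (Suc k)) G = broom_sum (edges G) k"
  using assms by (simp_all add: Ugraph_def hom_S0 hom_S21)

subsection \<open>Inequalities between homomorphism counts\<close>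

lemma weighted_Cauchy_Schwarz:
  fixes u x y :: "'a \<Rightarrow> real"
  assumes "\<And>i. i \<in> I \<Longrightarrow> 0 \<le> u i"
  shows "(\<Sum>i\<in>I. u i * x i * y i)\<^sup>2 \<le> (\<Sum>i\<in>I. u i * (x i)\<^sup>2) * (\<Sum>i\<in>I. u i * (y i)\<^sup>2)"
proof -
  have "(\<Sum>i\<in>I. u i * x i * y i) = (\<Sum>i\<in>I. (sqrt (u i) * x i) * (sqrt (u i) * y i))"
    by (rule sum.cong) (use assms in \<open>auto simp: algebra_simps\<close>)
  moreover have "(\<Sum>i\<in>I. u i * (z i)\<^sup>2) = (\<Sum>i\<in>I. (sqrt (u i) * z i)\<^sup>2)" for z
    by (rule sum.cong) (use assms in \<open>auto simp: power_mult_distrib\<close>)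
  ultimately show ?thesis
    using Cauchy_Schwarz_ineq_sum[of "\<lambda>i. sqrt (u i) * x i" "\<lambda>i. sqrt (u i) * y i" I] by simp
qed

text \<open>Links two successive Cauchy-Schwarz estimates by eliminating the intermediate sum
  \<open>z\<close>.\<close>

lemma fourth_power_chain:
  fixes x y z s t r :: real
  assumes "x\<^sup>2 \<le> y * z" "z\<^sup>2 \<le> s * t" "s \<le> r" "0 \<le> t"
  shows "x ^ 4 \<le> y\<^sup>2 * (r * t)"
proof -
  have "x ^ 4 = (x\<^sup>2)\<^sup>2" by simp
  also have "\<dots> \<le> (y * z)\<^sup>2"
    using assms(1) by (intro power_mono) auto
  also have "\<dots> = y\<^sup>2 * z\<^sup>2"
    by (rule power_mult_distrib)
  also have "z\<^sup>2 \<le> r * t"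
    using assms(2) mult_right_mono[OF assms(3,4)] by linarith
  finally show ?thesis by (simp add: mult_left_mono)
qed

section \<open>Degree sums of a fixed graph and their Cauchy-Schwarz estimates\<close>

locale finite_graph =
  fixes G :: graph
  assumes is_graph: "is_graph G"
begin

abbreviation "V \<equiv> verts G"
abbreviation "E \<equiv> edges G"
abbreviation "N v \<equiv> E `` {v}"

definition d :: "nat \<Rightarrow> real" where "d v = real (deg E v)"
definition w :: "nat \<Rightarrow> real" where "w v = (\<Sum>u\<in>N v. d u)"
definition a :: "nat \<Rightarrow> real" where "a k = real (broom_sum E k)"

lemmas fin = is_graphD[OF is_graph]

lemma N_subset: "N v \<subseteq> V"
  using fin(3) by auto

lemma d_eq: "d v = (\<Sum>u\<in>N v. 1)"
  by (simp add: d_def deg_def)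

lemma edge_sum: "(\<Sum>(u, v)\<in>E. f u v) = (\<Sum>u\<in>V. \<Sum>v\<in>N u. f u v)"
proof -
  have "E = Sigma V (\<lambda>u. N u)"
    using fin(3) by auto
  then have "(\<Sum>(u, v)\<in>E. f u v) = (\<Sum>(u, v)\<in>Sigma V (\<lambda>u. N u). f u v)"
    by simp
  also have "\<dots> = (\<Sum>u\<in>V. \<Sum>v\<in>N u. f u v)"
    by (rule sum.Sigma[symmetric]) (use fin in auto)
  finally show ?thesis .
qed

lemma edge_sum_swap: "(\<Sum>u\<in>V. \<Sum>v\<in>N u. f u v) = (\<Sum>u\<in>V. \<Sum>v\<in>N u. f v u)"
proof -
  have "(\<Sum>(u, v)\<in>E. f u v) = (\<Sum>(u, v)\<in>E. f v u)"
    by (rule sum.reindex_bij_witness[of _ prod.swap prod.swap])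
      (use fin(4) in \<open>auto dest: symD\<close>)
  then show ?thesis
    by (simp add: edge_sum)
qed

lemma a_eq: "a k = (\<Sum>v\<in>V. d v ^ k * w v)"
  by (simp add: a_def broom_sum_def w_def sum_distrib_left edge_sum[symmetric] d_def
      flip: of_nat_power of_nat_mult) (simp add: case_prod_unfold)

lemma d_nonneg [simp]: "0 \<le> d v"
  by (simp add: d_def)

lemma w_nonneg [simp]: "0 \<le> w v"
  by (simp add: w_def sum_nonneg)

lemma a_nonneg [simp]: "0 \<le> a k"
  by (simp add: a_def)

text \<open>Swapping the ends of each edge makes every vertex contribute its own degree once per
  neighbour.\<close>

lemma a0_eq: "a 0 = (\<Sum>v\<in>V. (d v)\<^sup>2)"
proof -
  have "a 0 = (\<Sum>u\<in>V. \<Sum>v\<in>N u. d u)"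
    unfolding a_eq w_def using edge_sum_swap[of "\<lambda>u v. d v"] by simp
  then show ?thesis
    by (simp add: d_def deg_def power2_eq_square)
qed

lemma w_ge_d: "d v \<le> w v"
proof -
  have "1 \<le> d u" if "u \<in> N v" for u
  proof -
    have "v \<in> N u" using that fin(4) by (auto dest: symD)
    then have "0 < card (N u)" using fin(5) card_gt_0_iff by blast
    then show ?thesis by (simp add: d_def deg_def)
  qed
  then show ?thesis
    unfolding w_def d_eq[of v] by (intro sum_mono) auto
qed

text \<open>Cauchy-Schwarz against the constant 1 on the \<open>d v\<close> neighbours of
  \<open>v\<close>.\<close>

lemma w_square_le_neighbours: "(w v)\<^sup>2 \<le> d v * (\<Sum>u\<in>N v. (d u)\<^sup>2)"
  using weighted_Cauchy_Schwarz[of "N v" "\<lambda>_. 1" "\<lambda>_. 1" d] by (simp add: w_def d_eq[of v])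

lemma w_square_le: "(w v)\<^sup>2 \<le> d v * a 0"
proof -
  have "(\<Sum>u\<in>N v. (d u)\<^sup>2) \<le> a 0"
    unfolding a0_eq by (rule sum_mono2) (use fin N_subset in auto)
  then show ?thesis
    using w_square_le_neighbours[of v] by (meson d_nonneg mult_left_mono order_trans)
qed

text \<open>An isolated vertex has \<open>w v = 0\<close>; at any other vertex the extra factor
  \<open>d v\<close> is at least 1.\<close>

lemma a_mono_Suc: "a k \<le> a (Suc k)"
proof -
  have "d v ^ k * w v \<le> d v ^ Suc k * w v" for v
  proof (cases "N v = {}")
    case True then show ?thesis by (simp add: w_def)
  next
    case False
    then have "1 \<le> d v"
      using fin(5) by (simp add: d_def deg_def Suc_le_eq card_gt_0_iff)
    then show ?thesis
      by (intro mult_right_mono) (auto intro: power_increasing)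
  qed
  then show ?thesis
    unfolding a_eq by (intro sum_mono)
qed

text \<open>Cauchy-Schwarz for the functions 1 and \<open>d\<close> with weights
  \<open>d v ^ k * w v\<close>.\<close>

lemma a_log_convex: "(a (Suc k))\<^sup>2 \<le> a k * a (Suc (Suc k))"
  using weighted_Cauchy_Schwarz[of V "\<lambda>v. d v ^ k * w v" "\<lambda>_. 1" d]
  by (simp add: a_eq algebra_simps power2_eq_square)

text \<open>Two of the three factors \<open>w v\<close> are traded for
  \<open>d v * a 0\<close>.\<close>

lemma w_cube_weight: "(\<Sum>v\<in>V. d v ^ k * w v ^ 3) \<le> a 0 * a (Suc k)"
proof -
  have "d v ^ k * w v ^ 3 \<le> a 0 * (d v ^ Suc k * w v)" for v
  proof -
    have "d v ^ k * w v ^ 3 = (d v ^ k * w v) * (w v)\<^sup>2"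
      by (simp add: power3_eq_cube power2_eq_square)
    also have "\<dots> \<le> (d v ^ k * w v) * (d v * a 0)"
      by (rule mult_left_mono[OF w_square_le]) simp
    finally show ?thesis by (simp add: algebra_simps)
  qed
  then show ?thesis
    unfolding a_eq[of "Suc k"] sum_distrib_left by (intro sum_mono)
qed

text \<open>Cauchy-Schwarz splits \<open>a 1\<close> into \<open>d\<close> and \<open>w\<close>,
  then the sum of \<open>w\<close> squared into \<open>w\<close> and 1 with weight \<open>w\<close>;
  the resulting cubes are bounded by \<open>a 0 * a 1\<close>. After division by \<open>a 1\<close>
  this is the facet \<open>4 * y 1 - 3 * y 2\<close>.\<close>

lemma a1_fourth_power_le: "a 1 ^ 4 \<le> a 0 ^ 4 * a 1"
proof -
  let ?W = "\<Sum>v\<in>V. (w v)\<^sup>2"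
  have "(a 1)\<^sup>2 \<le> a 0 * ?W"
    using weighted_Cauchy_Schwarz[of V "\<lambda>_. 1" d w] by (simp add: a_eq[of "Suc 0"] a0_eq)
  moreover have "?W\<^sup>2 \<le> (\<Sum>v\<in>V. w v ^ 3) * a 0"
    using weighted_Cauchy_Schwarz[of V w w "\<lambda>_. 1"]
    by (simp add: a_eq power2_eq_square power3_eq_cube mult.assoc)
  moreover have "(\<Sum>v\<in>V. w v ^ 3) \<le> a 0 * a 1"
    using w_cube_weight[of 0] by simp
  ultimately show ?thesis
    using fourth_power_chain[of "a 1" "a 0" ?W "\<Sum>v\<in>V. w v ^ 3" "a 0" "a 0 * a 1"] a_nonneg
    by (simp add: sum_nonneg eval_nat_numeral algebra_simps)
qed

text \<open>Same scheme: first the split into \<open>d\<close> and \<open>d * w\<close>, then the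
  functions \<open>w\<close> and \<open>d\<close> with weight \<open>d * w\<close>. In logarithms it
  is the facet \<open>3 * y 1 - 3 * y 3 + y 4\<close>.\<close>

lemma a2_fourth_power_le: "a 2 ^ 4 \<le> a 0 ^ 3 * a 2 * a 3"
proof -
  let ?W = "\<Sum>v\<in>V. (d v)\<^sup>2 * (w v)\<^sup>2"
  have "(a 2)\<^sup>2 \<le> a 0 * ?W"
    using weighted_Cauchy_Schwarz[of V "\<lambda>_. 1" d "\<lambda>v. d v * w v"]
    by (simp add: a_eq[of 2] a0_eq power2_eq_square algebra_simps)
  moreover have "?W\<^sup>2 \<le> (\<Sum>v\<in>V. d v ^ 1 * w v ^ 3) * a 3"
    using weighted_Cauchy_Schwarz[of V "\<lambda>v. d v * w v" w d]
    by (simp add: a_eq[of 3] power2_eq_square power3_eq_cube algebra_simps)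
  moreover have "(\<Sum>v\<in>V. d v ^ 1 * w v ^ 3) \<le> a 0 * a 2"
    using w_cube_weight[of 1] by (simp add: numeral_2_eq_2)
  ultimately show ?thesis
    using fourth_power_chain[of "a 2" "a 0" ?W "\<Sum>v\<in>V. d v ^ 1 * w v ^ 3" "a 3" "a 0 * a 2"] a_nonneg
    by (simp add: sum_nonneg eval_nat_numeral algebra_simps)
qed

text \<open>\<open>a 0\<close> is the plain sum of \<open>w\<close>. After Cauchy-Schwarz, each
  squared \<open>w v\<close> is bounded over the neighbourhood of \<open>v\<close>, and swapping
  edge ends turns the total into \<open>a 2\<close>.\<close>

lemma a0_square_le: "(a 0)\<^sup>2 \<le> card V * a 2"
proof -
  have "(a 0)\<^sup>2 \<le> card V * (\<Sum>v\<in>V. (w v)\<^sup>2)"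
    using weighted_Cauchy_Schwarz[of V "\<lambda>_. 1" "\<lambda>_. 1" w] by (simp add: a_eq)
  also have "(\<Sum>v\<in>V. (w v)\<^sup>2) \<le> (\<Sum>v\<in>V. d v * (\<Sum>u\<in>N v. (d u)\<^sup>2))"
    by (intro sum_mono w_square_le_neighbours)
  also have "\<dots> = a 2"
    using edge_sum_swap[of "\<lambda>u v. d u * (d v)\<^sup>2"]
    by (simp add: a_eq w_def sum_distrib_left mult.commute)
  finally show ?thesis
    by (simp add: mult_left_mono)
qed

section \<open>Bounds through the maximum degree\<close>

lemma max_degree:
  assumes "V \<noteq> {}"
  obtains v where "v \<in> V" "\<And>k. a (Suc k) \<le> d v * a k"
proof -
  have "Max (d ` V) \<in> d ` V"
    using fin(1) assms by (intro Max_in) auto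
  then obtain v where v: "v \<in> V" "Max (d ` V) = d v"
    by auto
  then have "d u \<le> d v" if "u \<in> V" for u
    using Max_ge[of "d ` V" "d u"] that fin(1) by auto
  note v = v(1) this
  have "a (Suc k) \<le> d v * a k" for k
    unfolding a_eq sum_distrib_left
  proof (rule sum_mono)
    fix u assume "u \<in> V"
    then have "d u * (d u ^ k * w u) \<le> d v * (d u ^ k * w u)"
      by (intro mult_right_mono v) auto
    then show "d u ^ Suc k * w u \<le> d v * (d u ^ k * w u)" by (simp add: mult.assoc)
  qed
  with v that show thesis by blast
qed

lemma d_le_card: "d v \<le> card V"
  unfolding d_def deg_def using card_mono[OF fin(1) N_subset] by simp

lemma d_square_le: "v \<in> V \<Longrightarrow> (d v)\<^sup>2 \<le> a 0"
  unfolding a0_eq by (rule member_le_sum) (auto simp: fin)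

lemma d_power_le: 
  assumes "v \<in> V"
  shows "d v ^ Suc k \<le> a k"
proof -
  have "d v ^ Suc k \<le> d v ^ k * w v"
    using mult_left_mono[OF w_ge_d, of "d v ^ k" v] by (simp add: mult.commute)
  also have "\<dots> \<le> a k"
    unfolding a_eq by (rule member_le_sum[OF assms]) (auto simp: fin)
  finally show ?thesis .
qed

text \<open>Passing from \<open>a k\<close> to \<open>a (Suc k)\<close> costs at most the maximum
  degree, which is bounded by the number of vertices, by the square root of \<open>a 0\<close>, and
  by the root of order \<open>Suc k\<close> of \<open>a k\<close>.\<close>

lemma a_Suc_bounds:
  assumes "V \<noteq> {}"
  shows "a (Suc k) \<le> card V * a k" "(a (Suc k))\<^sup>2 \<le> a 0 * (a k)\<^sup>2"
    "a (Suc k) ^ Suc k \<le> a k ^ Suc (Suc k)"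
proof -
  obtain v where D: "v \<in> V" "\<And>k. a (Suc k) \<le> d v * a k"
    using max_degree[OF assms] by blast
  show "a (Suc k) \<le> card V * a k"
    using D(2)[of k] mult_right_mono[OF d_le_card[of v] a_nonneg[of k]] by linarith
  have "(a (Suc k))\<^sup>2 \<le> (d v * a k)\<^sup>2"
    using D(2) by (intro power_mono) auto
  also have "\<dots> \<le> a 0 * (a k)\<^sup>2"
    using d_square_le[OF D(1)] by (simp add: power_mult_distrib mult_right_mono)
  finally show "(a (Suc k))\<^sup>2 \<le> a 0 * (a k)\<^sup>2" .
  have "a (Suc k) ^ Suc k \<le> (d v * a k) ^ Suc k"
    using D(2) by (intro power_mono) auto
  also have "\<dots> = d v ^ Suc k * a k ^ Suc k"
    by (rule power_mult_distrib)
  also have "\<dots> \<le> a k * a k ^ Suc k"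
    using d_power_le[OF D(1)] by (intro mult_right_mono) auto
  finally show "a (Suc k) ^ Suc k \<le> a k ^ Suc (Suc k)" by simp
qed

end

subsection \<open>The tropicalization lies in the cone\<close>

text \<open>Three coordinates suffice because no facet of \<open>Qset\<close> involves more; shorter
  ones take coefficient 0.\<close>

lemma conic_comb_functional_nonneg:
  fixes a b c :: real
  assumes "z \<in> conic_comb S" "\<And>x. x \<in> S \<Longrightarrow> 0 \<le> a * x i + b * x j + c * x k"
  shows "0 \<le> a * z i + b * z j + c * z k"
proof -
  obtain n e x where z: "z = (\<lambda>i. \<Sum>l<n. e l * x l i)"
    and ex: "\<forall>l<(n::nat). 0 \<le> e l \<and> x l \<in> S"
    using assms(1) unfolding conic_comb_def by blast
  have "a * z i + b * z j + c * z k = (\<Sum>l<n. e l * (a * x l i + b * x l j + c * x l k))"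
    by (simp add: z sum_distrib_left sum.distrib algebra_simps)
  also have "0 \<le> \<dots>"
    using ex assms(2) by (intro sum_nonneg mult_nonneg_nonneg) auto
  finally show ?thesis .
qed

lemma closure_functional_nonneg:
  fixes a b c :: real
  assumes y: "y \<in> closure_m m T" and le: "i \<le> m" "j \<le> m" "k \<le> m"
    and T: "\<And>z. z \<in> T \<Longrightarrow> 0 \<le> a * z i + b * z j + c * z k"
  shows "0 \<le> a * y i + b * y j + c * y k"
proof (rule ccontr)
  define L where "L = - (a * y i + b * y j + c * y k)"
  \<comment> \<open>The summand 1 keeps \<open>K\<close> positive and makes the total deviation fall
    strictly short of \<open>L\<close>.\<close>
  define K where "K = \<bar>a\<bar> + \<bar>b\<bar> + \<bar>c\<bar> + 1"
  assume "\<not> 0 \<le> a * y i + b * y j + c * y k"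
  then have "0 < L" "0 < K" by (auto simp: L_def K_def)
  then obtain z where z: "z \<in> T" "\<And>l. l \<le> m \<Longrightarrow> \<bar>y l - z l\<bar> < L / K"
    using y unfolding closure_m_def by (auto, metis divide_pos_pos)
  have bound: "t * z l - t * y l \<le> \<bar>t\<bar> * (L / K)" if "l \<le> m" for t l
  proof -
    have "t * z l - t * y l \<le> \<bar>t\<bar> * \<bar>y l - z l\<bar>"
      by (metis abs_ge_self abs_minus_commute abs_mult right_diff_distrib)
    also have "\<dots> \<le> \<bar>t\<bar> * (L / K)"
      using z(2)[OF that] by (intro mult_left_mono) auto
    finally show ?thesis .
  qed
  have "a * z i + b * z j + c * z k + L \<le> (\<bar>a\<bar> + \<bar>b\<bar> + \<bar>c\<bar>) * (L / K)"
    using bound[OF le(1), of a] bound[OF le(2), of b] bound[OF le(3), of c]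
    unfolding distrib_right using L_def by linarith
  also have "\<dots> = K * (L / K) - L / K"
  proof -
    have "\<bar>a\<bar> + \<bar>b\<bar> + \<bar>c\<bar> = K - 1" by (simp add: K_def)
    then show ?thesis by (simp only: left_diff_distrib mult_1_left)
  qed
  also have "\<dots> < L"
    using \<open>0 < L\<close> \<open>0 < K\<close> by simp
  finally show False
    using T[OF z(1)] by linarith
qed

lemma log_profileE:
  assumes "x \<in> log_profile m"
  obtains G where "finite_graph G" "0 < card (verts G)" "x 0 = ln (card (verts G))"
    "\<forall>k<m. 0 < finite_graph.a G k \<and> x (Suc k) = ln (finite_graph.a G k)"
proof -
  obtain G where x: "x = (\<lambda>i. if i \<le> m then ln (real (hom (Ugraph i) G)) else 0)"
    and G: "is_graph G" and pos: "\<forall>i\<le>m. 0 < hom (Ugraph i) G"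
    using assms unfolding log_profile_def by blast
  interpret finite_graph G by unfold_locales (fact G)
  have "hom (Ugraph (Suc k)) G = a k" for k
    using hom_Ugraph[OF G] by (simp add: a_def)
  moreover have "0 < real (hom (Ugraph (Suc k)) G)" if "k < m" for k
    using pos that by simp
  moreover have "0 < hom (Ugraph 0) G" using pos by blast
  ultimately show thesis
    using that[of G] x hom_Ugraph(1)[OF G] finite_graph_axioms by simp
qed

lemma log_profile_inequalities:
  assumes m: "m \<ge> 4" and x: "x \<in> log_profile m"
  shows "- x 1 + x 2 \<ge> 0" "4 * x 1 - 3 * x 2 \<ge> 0" "3 * x 1 - 3 * x 3 + x 4 \<ge> 0"
    "x 1 + 2 * x (m-1) - 2 * x m \<ge> 0" "x 0 + x (m-1) - x m \<ge> 0" "x 0 - 2 * x 1 + x 3 \<ge> 0"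
    "2 \<le> i \<Longrightarrow> i \<le> m - 1 \<Longrightarrow> x (i-1) - 2 * x i + x (i+1) \<ge> 0"
    "real m * x (m-1) - real (m-1) * x m \<ge> 0"
proof -
  obtain G where G: "finite_graph G" and n: "0 < card (verts G)" "x 0 = ln (card (verts G))"
    and pos: "\<forall>k<m. 0 < finite_graph.a G k \<and> x (Suc k) = ln (finite_graph.a G k)"
    using log_profileE[OF x] .
  then have apos: "0 < finite_graph.a G k" and xa: "x (Suc k) = ln (finite_graph.a G k)" if "k < m" for k
    using that by blast+
  interpret finite_graph G by (fact G)
  have V: "V \<noteq> {}" using n by auto
  have p: "0 < a 0" "0 < a 1" "0 < a 2" "0 < a 3"
    using apos m by auto
  have x1: "x 1 = ln (a 0)" "x 2 = ln (a 1)" "x 3 = ln (a 2)" "x 4 = ln (a 3)"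
    using xa[of 0] xa[of 1] xa[of 2] xa[of 3] m by (simp_all add: eval_nat_numeral)
  show "- x 1 + x 2 \<ge> 0"
    using a_mono_Suc[of 0] p unfolding x1 by simp
  have "ln (a 1 ^ 4) \<le> ln (a 0 ^ 4 * a 1)"
    using a1_fourth_power_le p by simp
  then show "4 * x 1 - 3 * x 2 \<ge> 0"
    using p unfolding x1 by (simp add: ln_mult ln_realpow)
  have "ln (a 2 ^ 4) \<le> ln (a 0 ^ 3 * a 2 * a 3)"
    using a2_fourth_power_le p by simp
  then show "3 * x 1 - 3 * x 3 + x 4 \<ge> 0"
    using p unfolding x1 by (simp add: ln_mult ln_realpow)
  have "ln ((a 0)\<^sup>2) \<le> ln (card V * a 2)"
    using a0_square_le p n by simp
  then show "x 0 - 2 * x 1 + x 3 \<ge> 0"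
    using p n unfolding x1 by (simp add: ln_mult ln_realpow)
  \<comment> \<open>Coordinate \<open>i\<close> is the logarithm of \<open>a (i - 1)\<close>, so the
    last two coordinates belong to \<open>a k\<close> and \<open>a (Suc k)\<close>.\<close>
  define k where "k = m - 2"
  have k: "m = Suc (Suc k)" "m - 1 = Suc k" "x (m - 1) = ln (a k)" "x m = ln (a (Suc k))"
    using m xa[of k] xa[of "Suc k"] by (simp_all add: k_def Suc_diff_Suc numeral_2_eq_2)
  have pk: "0 < a k" "0 < a (Suc k)"
    using apos k(1) by auto
  have "ln (a (Suc k)) \<le> ln (card V * a k)"
    using a_Suc_bounds(1)[OF V] pk n by simp
  then show "x 0 + x (m-1) - x m \<ge> 0"
    using pk n unfolding k(3,4) by (simp add: ln_mult)
  have "ln ((a (Suc k))\<^sup>2) \<le> ln (a 0 * (a k)\<^sup>2)"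
    using a_Suc_bounds(2)[OF V, of k] pk p by simp
  then show "x 1 + 2 * x (m-1) - 2 * x m \<ge> 0"
    using pk p unfolding k(3,4) x1 by (simp add: ln_mult ln_realpow)
  have "ln (a (Suc k) ^ Suc k) \<le> ln (a k ^ Suc (Suc k))"
    using a_Suc_bounds(3)[OF V, of k] pk by (simp only: ln_le_cancel_iff zero_less_power)
  then show "real m * x (m-1) - real (m-1) * x m \<ge> 0"
    using pk unfolding k(3,4) unfolding k(2) unfolding k(1) by (simp only: ln_realpow)
  assume i: "2 \<le> i" "i \<le> m - 1"
  define l where "l = i - 2"
  have l: "i - 1 = Suc l" "i = Suc (Suc l)" "i + 1 = Suc (Suc (Suc l))" "Suc (Suc l) < m"
    using i by (auto simp: l_def)
  have pl: "0 < a l" "0 < a (Suc l)" "0 < a (Suc (Suc l))"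
    using apos l(4) by auto
  have "ln ((a (Suc l))\<^sup>2) \<le> ln (a l * a (Suc (Suc l)))"
    using a_log_convex[of l] pl by simp
  then show "x (i-1) - 2 * x i + x (i+1) \<ge> 0"
    unfolding l(1) l(3) unfolding l(2) using pl xa l(4) by (simp add: ln_mult ln_realpow)
qed

lemma trop_profile_subset_Qset:
  assumes m: "m \<ge> 4"
  shows "trop_profile m \<subseteq> Qset m"
proof
  fix y assume y: "y \<in> trop_profile m"
  have *: "0 \<le> a * y i + b * y j + c * y k"
    if "\<And>x. x \<in> log_profile m \<Longrightarrow> 0 \<le> a * x i + b * x j + c * x k" "i \<le> m" "j \<le> m" "k \<le> m"
    for a b c i j k
    using y[unfolded trop_profile_def] that(2-4)
    by (rule closure_functional_nonneg) (rule conic_comb_functional_nonneg[OF _ that(1)])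
  note I = log_profile_inequalities[OF m]
  have "y i = 0" if "i > m" for i
    using y that by (simp add: trop_profile_def closure_m_def)
  moreover have "- y 1 + y 2 \<ge> 0"
    using *[of "-1" 1 1 2 0 0] I(1) m by simp
  moreover have "4 * y 1 - 3 * y 2 \<ge> 0"
    using *[of 4 1 "-3" 2 0 0] I(2) m by simp
  moreover have "3 * y 1 - 3 * y 3 + y 4 \<ge> 0"
    using *[of 3 1 "-3" 3 1 4] I(3) m by simp
  moreover have "y 1 + 2 * y (m-1) - 2 * y m \<ge> 0"
    using *[of 1 1 2 "m-1" "-2" m] I(4) m by simp
  moreover have "y 0 + y (m-1) - y m \<ge> 0"
    using *[of 1 0 1 "m-1" "-1" m] I(5) m by simp
  moreover have "y 0 - 2 * y 1 + y 3 \<ge> 0"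
    using *[of 1 0 "-2" 1 1 3] I(6) m by simp
  moreover have "y (i-1) - 2 * y i + y (i+1) \<ge> 0" if "2 \<le> i" "i \<le> m - 1" for i
    using *[of 1 "i-1" "-2" i 1 "i+1"] I(7)[OF _ that] that m by simp
  moreover have "real m * y (m-1) - real (m-1) * y m \<ge> 0"
    using *[of "real m" "m-1" "- real (m-1)" m 0 0] I(8) m by (simp add: algebra_simps)
  ultimately show "y \<in> Qset m"
    unfolding Qset_def by blast
qed

subsection \<open>Disjoint unions and maxima of exponents\<close>

text \<open>Some graphs have growth exponents at most \<open>y\<close>, with equality on the coordinates \<open>I\<close>;
  the scale is \<open>n = exp t\<close>.\<close>

definition achieves :: "nat \<Rightarrow> (nat \<Rightarrow> real) \<Rightarrow> nat set \<Rightarrow> bool" where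
  "achieves m y I \<longleftrightarrow> (\<exists>C. \<forall>t\<ge>0. \<exists>G. is_graph G
     \<and> (\<forall>i\<le>m. real (hom (Ugraph i) G) \<le> C * exp (t * y i))
     \<and> (\<forall>i\<in>I. exp (t * y i) \<le> real (hom (Ugraph i) G)))"

text \<open>The logarithmic vector of the graph at scale \<open>t\<close>, divided by
  \<open>t\<close>, is within \<open>ln C / t\<close> of \<open>y\<close>.\<close>

lemma achieves_imp_trop:
  assumes y: "\<forall>i>m. y i = 0" and ach: "achieves m y {..m}"
  shows "y \<in> trop_profile m"
proof -
  obtain C where C: "\<And>t. 0 \<le> t \<Longrightarrow> \<exists>G. is_graph G
     \<and> (\<forall>i\<le>m. real (hom (Ugraph i) G) \<le> C * exp (t * y i))
     \<and> (\<forall>i\<in>{..m}. exp (t * y i) \<le> real (hom (Ugraph i) G))"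
    using ach unfolding achieves_def by blast
  obtain G where "real (hom (Ugraph 0) G) \<le> C * exp (0 * y 0)" "exp (0 * y 0) \<le> real (hom (Ugraph 0) G)"
    using C[OF order_refl] by blast
  then have "1 \<le> C" by simp
  have "\<exists>z\<in>conic_comb (log_profile m). \<forall>i\<le>m. \<bar>y i - z i\<bar> < e" if "0 < e" for e
  proof -
    \<comment> \<open>Chosen so that \<open>ln C / t < e\<close>; the added 1 keeps \<open>t\<close>
      positive when \<open>C = 1\<close>.\<close>
    define t where "t = (ln C + 1) / e"
    have t: "0 < t"
      using \<open>1 \<le> C\<close> that by (simp add: t_def add_nonneg_pos)
    obtain G where G: "is_graph G"
      and up: "\<And>i. i \<le> m \<Longrightarrow> real (hom (Ugraph i) G) \<le> C * exp (t * y i)"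
      and lo: "\<And>i. i \<le> m \<Longrightarrow> exp (t * y i) \<le> real (hom (Ugraph i) G)"
      using C[of t] t by auto
    have pos: "0 < real (hom (Ugraph i) G)" if "i \<le> m" for i
      using lo[OF that] exp_gt_zero less_le_trans by blast
    define x where "x = (\<lambda>i. if i \<le> m then ln (real (hom (Ugraph i) G)) else 0)"
    have "x \<in> log_profile m"
      using G pos unfolding log_profile_def x_def by (intro CollectI exI[of _ G]) simp
    then have z: "(\<lambda>i. \<Sum>j<(1::nat). (1 / t) * x i) \<in> conic_comb (log_profile m)"
      unfolding conic_comb_def using t
      by (intro CollectI exI[of _ 1] exI[of _ "\<lambda>_. 1 / t"] exI[of _ "\<lambda>_. x"]) auto
    have "\<bar>y i - (1 / t) * x i\<bar> < e" if i: "i \<le> m" for i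
    proof -
      have "t * y i \<le> x i"
        using lo[OF i] pos[OF i] i by (simp add: x_def ln_ge_iff)
      moreover have "x i \<le> ln (C * exp (t * y i))"
        using up[OF i] pos[OF i] i by (simp add: x_def)
      then have "x i \<le> ln C + t * y i"
        using \<open>1 \<le> C\<close> by (simp add: ln_mult)
      ultimately have "y i \<le> (1 / t) * x i" "(1 / t) * x i \<le> ln C / t + y i"
        using t by (simp_all add: field_simps)
      moreover have "ln C / t < e"
        using t that \<open>0 < e\<close> \<open>1 \<le> C\<close> by (simp add: t_def field_simps)
      ultimately show ?thesis by linarith
    qed
    then show ?thesis
      using z by (intro bexI[OF _ z]) simp
  qed
  then show ?thesis
    using y by (simp add: trop_profile_def closure_m_def)
qed

section \<open>Relabelling and disjoint union\<close>

lemma deg_image: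
  assumes "inj f"
  shows "deg (map_prod f f ` E) (f v) = deg E v"
proof -
  have "(map_prod f f ` E) `` {f v} = f ` (E `` {v})"
    using assms by (force simp: inj_def)
  then show ?thesis
    using assms by (simp add: deg_def card_image inj_on_subset)
qed

lemma broom_sum_image:
  assumes "inj f"
  shows "broom_sum (map_prod f f ` E) k = broom_sum E k"
proof -
  have "inj_on (map_prod f f) E"
    using assms by (auto simp: inj_on_def inj_def)
  then show ?thesis
    by (simp add: broom_sum_def sum.reindex case_prod_unfold deg_image[OF assms])
qed

lemma broom_sum_Un:
  assumes "finite E" "finite F" "E \<subseteq> A \<times> A" "F \<subseteq> B \<times> B" "A \<inter> B = {}"
  shows "broom_sum (E \<union> F) k = broom_sum E k + broom_sum F k"
proof -
  have E: "deg (E \<union> F) u = deg E u" if "u \<in> A" for u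
  proof -
    have "(E \<union> F) `` {u} = E `` {u}" using that assms by auto
    then show ?thesis by (simp add: deg_def)
  qed
  have F: "deg (E \<union> F) u = deg F u" if "u \<in> B" for u
  proof -
    have "(E \<union> F) `` {u} = F `` {u}" using that assms by auto
    then show ?thesis by (simp add: deg_def)
  qed
  have "broom_sum (E \<union> F) k = (\<Sum>(u, v)\<in>E. deg (E \<union> F) u ^ k * deg (E \<union> F) v)
      + (\<Sum>(u, v)\<in>F. deg (E \<union> F) u ^ k * deg (E \<union> F) v)"
    unfolding broom_sum_def by (rule sum.union_disjoint) (use assms in auto)
  also have "(\<Sum>(u, v)\<in>E. deg (E \<union> F) u ^ k * deg (E \<union> F) v) = broom_sum E k"
    unfolding broom_sum_def by (rule sum.cong) (use E assms in auto)
  also have "(\<Sum>(u, v)\<in>F. deg (E \<union> F) u ^ k * deg (E \<union> F) v) = broom_sum F k"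
    unfolding broom_sum_def by (rule sum.cong) (use F assms in auto)
  finally show ?thesis .
qed

lemma map_prod_image_iff:
  "(u, v) \<in> map_prod f f ` E \<longleftrightarrow> (\<exists>a b. u = f a \<and> v = f b \<and> (a, b) \<in> E)"
  by force

lemma disjoint_union:
  assumes G: "is_graph G" and H: "is_graph H"
  shows "\<exists>K. is_graph K \<and> (\<forall>i. hom (Ugraph i) K = hom (Ugraph i) G + hom (Ugraph i) H)"
proof -
  \<comment> \<open>Vertices are natural numbers, so the two graphs are made disjoint by moving one
    to the even and the other to the odd numbers.\<close>
  define f g :: "nat \<Rightarrow> nat" where "f = (\<lambda>x. 2 * x)" and "g = (\<lambda>x. 2 * x + 1)"
  have inj: "inj f" "inj g" by (auto simp: f_def g_def inj_def)
  have disj: "f ` A \<inter> g ` B = {}" for A B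
    by (auto simp: f_def g_def) presburger
  define K :: graph where "K = (f ` verts G \<union> g ` verts H,
    map_prod f f ` edges G \<union> map_prod g g ` edges H)"
  have K: "verts K = f ` verts G \<union> g ` verts H"
    "edges K = map_prod f f ` edges G \<union> map_prod g g ` edges H"
    by (simp_all add: K_def verts_def edges_def)
  note GH = is_graphD[OF G] is_graphD[OF H]
  have irr: "(u, u) \<notin> edges G" "(u, u) \<notin> edges H" for u
    using G H by (auto simp: is_graph_def)
  have sub: "map_prod f f ` edges G \<subseteq> f ` verts G \<times> f ` verts G"
    "map_prod g g ` edges H \<subseteq> g ` verts H \<times> g ` verts H"
    using GH by auto
  have "is_graph K"
    unfolding is_graph_def K
  proof (intro conjI allI impI)
    show "finite (f ` verts G \<union> g ` verts H)" using GH by simp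
    show "map_prod f f ` edges G \<union> map_prod g g ` edges H
        \<subseteq> (f ` verts G \<union> g ` verts H) \<times> (f ` verts G \<union> g ` verts H)"
      using sub by auto
    show "(v, u) \<in> map_prod f f ` edges G \<union> map_prod g g ` edges H"
      if "(u, v) \<in> map_prod f f ` edges G \<union> map_prod g g ` edges H" for u v
      using that GH(4) GH(9) unfolding map_prod_image_iff Un_iff by (blast dest: symD)
    show "(u, u) \<notin> map_prod f f ` edges G \<union> map_prod g g ` edges H" for u
      using irr inj unfolding map_prod_image_iff Un_iff by (metis injD)
  qed
  moreover have "hom (Ugraph i) K = hom (Ugraph i) G + hom (Ugraph i) H" for i
  proof (cases i)
    case 0
    have "card (verts K) = card (f ` verts G) + card (g ` verts H)"
      unfolding K by (rule card_Un_disjoint) (use GH disj in auto)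
    then show ?thesis
      using 0 inj G H \<open>is_graph K\<close> by (simp add: hom_Ugraph card_image inj_on_subset)
  next
    case (Suc k)
    have "broom_sum (edges K) k = broom_sum (map_prod f f ` edges G) k + broom_sum (map_prod g g ` edges H) k"
      unfolding K by (rule broom_sum_Un[OF _ _ sub disj]) (use GH in auto)
    then show ?thesis
      using Suc inj G H \<open>is_graph K\<close> by (simp add: hom_Ugraph broom_sum_image)
  qed
  ultimately show ?thesis by blast
qed

lemma is_graph_edgeless: "finite A \<Longrightarrow> is_graph (A, {})"
  by (simp add: is_graph_def verts_def edges_def)

lemma hom_Ugraph_edgeless:
  assumes "finite A"
  shows "hom (Ugraph i) (A, {}) = (if i = 0 then card A else 0)"
  by (cases i) (simp_all add: hom_Ugraph is_graph_edgeless assms, simp_all add: verts_def edges_def broom_sum_def)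

lemma disjoint_copies:
  assumes G: "is_graph G"
  shows "\<exists>K. is_graph K \<and> (\<forall>i. hom (Ugraph i) K = r * hom (Ugraph i) G)"
proof (induction r)
  case 0
  show ?case
    by (rule exI[of _ "({}, {})"]) (simp add: is_graph_edgeless hom_Ugraph_edgeless)
next
  case (Suc r)
  then obtain K where "is_graph K" "\<forall>i. hom (Ugraph i) K = r * hom (Ugraph i) G" by blast
  then show ?case
    using disjoint_union[OF G, of K] by simp
qed

text \<open>In a disjoint union the counts add: the lower bounds of both graphs survive and the
  upper constants add up.\<close>

lemma achieves_Un:
  assumes "achieves m y I" "achieves m y J"
  shows "achieves m y (I \<union> J)"
proof -
  obtain C where C: "\<And>t. 0 \<le> t \<Longrightarrow> \<exists>G. is_graph G
     \<and> (\<forall>i\<le>m. real (hom (Ugraph i) G) \<le> C * exp (t * y i))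
     \<and> (\<forall>i\<in>I. exp (t * y i) \<le> real (hom (Ugraph i) G))"
    using assms(1) unfolding achieves_def by blast
  obtain D where D: "\<And>t. 0 \<le> t \<Longrightarrow> \<exists>G. is_graph G
     \<and> (\<forall>i\<le>m. real (hom (Ugraph i) G) \<le> D * exp (t * y i))
     \<and> (\<forall>i\<in>J. exp (t * y i) \<le> real (hom (Ugraph i) G))"
    using assms(2) unfolding achieves_def by blast
  show ?thesis
    unfolding achieves_def
  proof (intro exI[of _ "C + D"] allI impI)
    fix t :: real assume t: "0 \<le> t"
    obtain G where G: "is_graph G" "\<And>i. i \<le> m \<Longrightarrow> real (hom (Ugraph i) G) \<le> C * exp (t * y i)"
      "\<And>i. i \<in> I \<Longrightarrow> exp (t * y i) \<le> real (hom (Ugraph i) G)"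
      using C[OF t] by blast
    obtain H where H: "is_graph H" "\<And>i. i \<le> m \<Longrightarrow> real (hom (Ugraph i) H) \<le> D * exp (t * y i)"
      "\<And>i. i \<in> J \<Longrightarrow> exp (t * y i) \<le> real (hom (Ugraph i) H)"
      using D[OF t] by blast
    obtain K where K: "is_graph K" "\<And>i. hom (Ugraph i) K = hom (Ugraph i) G + hom (Ugraph i) H"
      using disjoint_union[OF G(1) H(1)] by blast
    show "\<exists>G. is_graph G \<and> (\<forall>i\<le>m. real (hom (Ugraph i) G) \<le> (C + D) * exp (t * y i))
        \<and> (\<forall>i\<in>I \<union> J. exp (t * y i) \<le> real (hom (Ugraph i) G))"
      using K(1)
    proof (intro exI[of _ K] conjI allI impI ballI)
      show "real (hom (Ugraph i) K) \<le> (C + D) * exp (t * y i)" if "i \<le> m" for i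
        using G(2)[OF that] H(2)[OF that] by (simp add: K(2) distrib_right)
      show "exp (t * y i) \<le> real (hom (Ugraph i) K)" if "i \<in> I \<union> J" for i
        using that G(3)[of i] H(3)[of i] by (auto simp: K(2))
    qed
  qed
qed

lemma achieves_subset: "achieves m y I \<Longrightarrow> J \<subseteq> I \<Longrightarrow> achieves m y J"
  unfolding achieves_def by (meson subsetD)

lemma achieves_pointwise:
  assumes "finite I" "\<And>i. i \<in> I \<Longrightarrow> achieves m y {i}"
  shows "achieves m y I"
  using assms
proof (induction I)
  case empty
  show ?case
    unfolding achieves_def
    by (intro exI[of _ 0] allI impI exI[of _ "({}, {})"])
      (simp add: is_graph_edgeless hom_Ugraph_edgeless)
next
  case (insert i I)
  then have "achieves m y ({i} \<union> I)"
    by (intro achieves_Un) auto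
  then show ?case by simp
qed

text \<open>Rounding real parameters to integers costs only a factor 2, which the constant in
  \<open>achieves\<close> absorbs.\<close>

lemma nat_approx:
  fixes x :: real
  assumes "1 \<le> x"
  obtains n :: nat where "1 \<le> n" "x \<le> real n" "real n \<le> 2 * x"
proof -
  have "x \<le> real (nat \<lceil>x\<rceil>)" by (rule real_nat_ceiling_ge)
  moreover have "real (nat \<lceil>x\<rceil>) \<le> 2 * x"
    using assms by linarith
  ultimately show thesis
    using that[of "nat \<lceil>x\<rceil>"] assms by linarith
qed

text \<open>Isolated vertices raise coordinate 0 alone.\<close>

lemma achieves_vertices:
  assumes "0 \<le> y 0"
  shows "achieves m y {0}"
  unfolding achieves_def
proof (intro exI[of _ 2] allI impI)
  fix t :: real assume "0 \<le> t"
  then have "1 \<le> exp (t * y 0)" using assms by simp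
  then obtain n :: nat where "exp (t * y 0) \<le> real n" "real n \<le> 2 * exp (t * y 0)"
    by (rule nat_approx)
  then show "\<exists>G. is_graph G \<and> (\<forall>i\<le>m. real (hom (Ugraph i) G) \<le> 2 * exp (t * y i))
      \<and> (\<forall>i\<in>{0}. exp (t * y i) \<le> real (hom (Ugraph i) G))"
    by (intro exI[of _ "({..<n}, {})"]) (simp add: is_graph_edgeless hom_Ugraph_edgeless)
qed

subsection \<open>Hubs joined to cliques\<close>

text \<open>The vertices below \<open>p\<close> are the hubs; the others form \<open>q\<close> consecutive cliques of size \<open>c\<close>.\<close>

definition core :: "nat \<Rightarrow> nat \<Rightarrow> nat \<Rightarrow> graph" where
  "core p q c = ({..<p + q * c},
     {(u, v). u < p + q * c \<and> v < p + q * c \<and>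
        (u < p \<and> p \<le> v \<or> p \<le> u \<and> v < p \<or>
         p \<le> u \<and> p \<le> v \<and> u \<noteq> v \<and> (u - p) div c = (v - p) div c)})"

lemma verts_core: "verts (core p q c) = {..<p + q * c}"
  by (simp add: core_def verts_def)

lemma is_graph_core: "is_graph (core p q c)"
  by (auto simp: is_graph_def core_def verts_def edges_def)

lemma core_hub_neighbours:
  "u < p \<Longrightarrow> edges (core p q c) `` {u} = {p..<p + q * c}"
  by (auto simp: core_def edges_def)

lemma core_clique_neighbours:
  assumes "p \<le> u" "u < p + q * c" and b: "b = (u - p) div c"
  shows "edges (core p q c) `` {u} = {..<p} \<union> ({p + b * c..<p + b * c + c} - {u})"
    and "u \<in> {p + b * c..<p + b * c + c}"
    and "{p + b * c..<p + b * c + c} \<subseteq> {p..<p + q * c}"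
proof -
  have c: "0 < c" using assms by (cases c) auto
  \<comment> \<open>The quotient by \<open>c\<close> identifies the clique, an interval of
    \<open>c\<close> consecutive numbers.\<close>
  have block: "(v - p) div c = b \<longleftrightarrow> v \<in> {p + b * c..<p + b * c + c}" if "p \<le> v" for v
  proof -
    have "(v - p) div c = b \<longleftrightarrow> b * c \<le> v - p \<and> v - p < Suc b * c"
      using c by (metis div_nat_eqI dividend_less_div_times div_times_less_eq_dividend mult.commute mult_Suc)
    then show ?thesis
      by (simp add: le_diff_conv2[OF that] less_diff_conv2[OF that] ac_simps)
  qed
  have "b < q"
    using assms c by (simp add: b div_less_iff_less_mult)
  then have "Suc b * c \<le> q * c" by (intro mult_le_mono1) simp
  then show sub: "{p + b * c..<p + b * c + c} \<subseteq> {p..<p + q * c}" by auto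
  show u: "u \<in> {p + b * c..<p + b * c + c}"
    using block[OF assms(1)] b by simp
  have "(u, v) \<in> edges (core p q c) \<longleftrightarrow> v \<in> {..<p} \<union> ({p + b * c..<p + b * c + c} - {u})" for v
  proof (cases "v < p")
    case True
    then show ?thesis using assms by (simp add: core_def edges_def)
  next
    case False
    then have "v \<in> {p + b * c..<p + b * c + c} \<longleftrightarrow> v < p + q * c \<and> (v - p) div c = (u - p) div c"
      using block[of v] sub b by auto
    with False show ?thesis
      using assms by (auto simp: core_def edges_def)
  qed
  then show "edges (core p q c) `` {u} = {..<p} \<union> ({p + b * c..<p + b * c + c} - {u})"
    by blast
qed

lemma deg_core:
  shows "u < p \<Longrightarrow> deg (edges (core p q c)) u = q * c"
    and "p \<le> u \<Longrightarrow> u < p + q * c \<Longrightarrow> deg (edges (core p q c)) u = p + (c - 1)"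
proof -
  show "u < p \<Longrightarrow> deg (edges (core p q c)) u = q * c"
    by (simp add: deg_def core_hub_neighbours)
  assume u: "p \<le> u" "u < p + q * c"
  define b where "b = (u - p) div c"
  note N = core_clique_neighbours[OF u b_def]
  have "card ({..<p} \<union> ({p + b * c..<p + b * c + c} - {u}))
      = card {..<p} + card ({p + b * c..<p + b * c + c} - {u})"
    by (rule card_Un_disjoint) auto
  then show "deg (edges (core p q c)) u = p + (c - 1)"
    using N(2) by (simp add: deg_def N(1))
qed

text \<open>The first summand has its centre at a hub, whose neighbours are all clique vertices. The
  second has its centre at a clique vertex, which sees \<open>p\<close> hubs and
  \<open>c - 1\<close> vertices of its own clique.\<close>

lemma broom_sum_core:
  "broom_sum (edges (core p q c)) k = p * (q * c) ^ Suc k * (p + (c - 1))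
     + q * c * (p + (c - 1)) ^ k * (p * (q * c) + (c - 1) * (p + (c - 1)))"
proof -
  let ?E = "edges (core p q c)" and ?B = "{p..<p + q * c}"
  let ?e = "p + (c - 1)"
  interpret finite_graph "core p q c" by unfold_locales (rule is_graph_core)
  have hub: "(\<Sum>v\<in>?E `` {u}. deg ?E u ^ k * deg ?E v) = (q * c) ^ Suc k * ?e" if "u < p" for u
  proof -
    have "(\<Sum>v\<in>?B. deg ?E u ^ k * deg ?E v) = (\<Sum>v\<in>?B. (q * c) ^ k * ?e)"
      by (rule sum.cong) (use that deg_core in auto)
    then show ?thesis
      using that by (simp add: core_hub_neighbours)
  qed
  have clique: "(\<Sum>v\<in>?E `` {u}. deg ?E u ^ k * deg ?E v) = ?e ^ k * (p * (q * c) + (c - 1) * ?e)"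
    if u: "u \<in> ?B" for u
  proof -
    define b where "b = (u - p) div c"
    have u': "p \<le> u" "u < p + q * c" using u by auto
    note N = core_clique_neighbours[OF u' b_def]
    let ?K = "{p + b * c..<p + b * c + c} - {u}"
    have "(\<Sum>v\<in>?E `` {u}. deg ?E v) = (\<Sum>v<p. deg ?E v) + (\<Sum>v\<in>?K. deg ?E v)"
      unfolding N(1) by (rule sum.union_disjoint) auto
    also have "(\<Sum>v<p. deg ?E v) = p * (q * c)"
      by (simp add: deg_core(1))
    also have "(\<Sum>v\<in>?K. deg ?E v) = (\<Sum>v\<in>?K. ?e)"
      by (rule sum.cong) (use N(3) deg_core(2) in auto)
    also have "\<dots> = (c - 1) * ?e"
      using N(2) by simp
    finally show ?thesis
      using u' by (simp add: deg_core(2) flip: sum_distrib_left)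
  qed
  have "broom_sum ?E k = (\<Sum>u\<in>{..<p + q * c}. \<Sum>v\<in>?E `` {u}. deg ?E u ^ k * deg ?E v)"
    unfolding broom_sum_def edge_sum by (simp add: verts_core)
  also have "\<dots> = (\<Sum>u\<in>{..<p} \<union> ?B. \<Sum>v\<in>?E `` {u}. deg ?E u ^ k * deg ?E v)"
    by (rule sum.cong) auto
  also have "\<dots> = (\<Sum>u<p. \<Sum>v\<in>?E `` {u}. deg ?E u ^ k * deg ?E v)
      + (\<Sum>u\<in>?B. \<Sum>v\<in>?E `` {u}. deg ?E u ^ k * deg ?E v)"
    by (rule sum.union_disjoint) auto
  also have "\<dots> = p * ((q * c) ^ Suc k * ?e) + (q * c) * (?e ^ k * (p * (q * c) + (c - 1) * ?e))"
    using hub clique by simp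
  finally show ?thesis by (simp only: mult.assoc)
qed

text \<open>\<open>P\<close>, \<open>A\<close> and \<open>D\<close> are the intended number of hubs,
  hub degree and clique size. As \<open>P \<le> D\<close>, clique vertices have degree of order
  \<open>D\<close>, so the hub-centred and clique-centred parts are of the two displayed
  orders.\<close>

lemma broom_sum_core_bounds:
  fixes P A D :: real
  assumes P: "1 \<le> P" "P \<le> p" "p \<le> 2 * P" and A: "A \<le> q * c" "q * c \<le> 4 * A"
    and D: "1 \<le> D" "D \<le> c" "c \<le> 2 * D" and "P \<le> D" "D \<le> A" "D\<^sup>2 \<le> P * A"
  shows "P * A ^ Suc k * D \<le> broom_sum (edges (core p q c)) k"
    and "P * A\<^sup>2 * D ^ k \<le> broom_sum (edges (core p q c)) k"
    and "broom_sum (edges (core p q c)) k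
      \<le> 32 * 4 ^ k * (P * A ^ Suc k * D) + 64 * 4 ^ k * (P * A\<^sup>2 * D ^ k)"
proof -
  let ?e = "real (p + (c - 1))"
  have c: "1 \<le> c" "1 \<le> p" using P D by linarith+
  have e: "D \<le> ?e" "?e \<le> 4 * D" using P D \<open>P \<le> D\<close> c by linarith+
  have nn: "0 \<le> P" "0 \<le> A" "0 \<le> D" using P D \<open>D \<le> A\<close> by linarith+
  define X where "X = real p * (real (q * c)) ^ Suc k * ?e"
  define Y where "Y = real (q * c) * ?e ^ k * (real p * real (q * c) + real (c - 1) * ?e)"
  have XY: "real (broom_sum (edges (core p q c)) k) = X + Y"
    unfolding broom_sum_core X_def Y_def by simp
  have A': "A \<le> real (q * c)" "real (q * c) \<le> 4 * A" using A by simp_all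
  have X1: "P * A ^ Suc k * D \<le> X"
    unfolding X_def using P A' e nn by (intro mult_mono power_mono mult_nonneg_nonneg zero_le_power) auto
  have X2: "X \<le> (2 * P) * (4 * A) ^ Suc k * (4 * D)"
    unfolding X_def using P A' e nn by (intro mult_mono power_mono mult_nonneg_nonneg zero_le_power) auto
  \<comment> \<open>\<open>c - 1\<close> may be 0, so only the neighbours that are hubs are
    kept.\<close>
  have "A * D ^ k * (P * A + 0) \<le> Y"
    unfolding Y_def using P A' e nn by (intro mult_mono power_mono add_mono mult_nonneg_nonneg zero_le_power) auto
  then have Y1: "P * A\<^sup>2 * D ^ k \<le> Y"
    by (simp add: power2_eq_square algebra_simps)
  have "Y \<le> (4 * A) * (4 * D) ^ k * ((2 * P) * (4 * A) + (2 * D) * (4 * D))"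
    unfolding Y_def using P A' e D nn by (intro mult_mono power_mono add_mono mult_nonneg_nonneg zero_le_power) auto
  also have "(2 * P) * (4 * A) + (2 * D) * (4 * D) \<le> 16 * (P * A)"
    using \<open>D\<^sup>2 \<le> P * A\<close> by (simp add: power2_eq_square mult.commute)
  finally have Y2: "Y \<le> (4 * A) * (4 * D) ^ k * (16 * (P * A))"
    using nn by (simp add: mult_left_mono)
  have "0 \<le> X" "0 \<le> Y"
    by (simp_all add: X_def Y_def)
  then show "P * A ^ Suc k * D \<le> broom_sum (edges (core p q c)) k"
    "P * A\<^sup>2 * D ^ k \<le> broom_sum (edges (core p q c)) k"
    using X1 Y1 unfolding XY by linarith+
  show "broom_sum (edges (core p q c)) k
      \<le> 32 * 4 ^ k * (P * A ^ Suc k * D) + 64 * 4 ^ k * (P * A\<^sup>2 * D ^ k)"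
  proof -
    have "(2 * P) * (4 * A) ^ Suc k * (4 * D) = 32 * 4 ^ k * (P * A ^ Suc k * D)"
      by (simp add: power_mult_distrib)
    moreover have "(4 * A) * (4 * D) ^ k * (16 * (P * A)) = 64 * 4 ^ k * (P * A\<^sup>2 * D ^ k)"
      by (simp add: power_mult_distrib power2_eq_square)
    ultimately show ?thesis
      using X2 Y2 unfolding XY by linarith
  qed
qed

text \<open>At scale \<open>n\<close> take about \<open>n\<^sup>r\<close> copies with \<open>n\<^sup>p\<close> hubs and cliques of size \<open>n\<^sup>d\<close>, each hub having
  degree \<open>n\<^sup>a\<close>. The assumption \<open>2 * d \<le> p + a\<close> says that two-step walks from a clique
  vertex are dominated by those through a hub.\<close>

lemma achieves_core:
  fixes r p d a :: real
  assumes "0 \<le> r" "0 \<le> p" "p \<le> d" "d \<le> a" "2 * d \<le> p + a" and y0: "r + a \<le> y 0"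
    and hub: "\<And>k. k < m \<Longrightarrow> r + p + real (Suc k) * a + d \<le> y (Suc k)"
    and clique: "\<And>k. k < m \<Longrightarrow> r + p + 2 * a + real k * d \<le> y (Suc k)"
    and I: "\<And>i. i \<in> I \<Longrightarrow> \<exists>k<m. i = Suc k \<and>
      (y i = r + p + real (Suc k) * a + d \<or> y i = r + p + 2 * a + real k * d)"
  shows "achieves m y I"
  unfolding achieves_def
\<comment> \<open>192 is \<open>2 * (32 + 64)\<close>: both terms of the bound for
  \<open>core\<close>, doubled by rounding the number of copies.\<close>
proof (intro exI[of _ "192 * 4 ^ m"] allI impI)
  fix t :: real assume t: "0 \<le> t"
  \<comment> \<open>\<open>X x\<close> is the scale \<open>exp t\<close> raised to the power
    \<open>x\<close>, so products become sums of exponents.\<close>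
  define X where "X = (\<lambda>x. exp (t * x))"
  have X_add: "X (x + x') = X x * X x'" for x x'
    by (simp add: X_def distrib_left exp_add)
  have X_mult: "X (real n * x) = X x ^ n" for n x
    by (simp add: X_def mult.left_commute flip: exp_of_nat_mult)
  have X_mono: "X x \<le> X x'" if "x \<le> x'" for x x'
    using that t by (simp add: X_def mult_left_mono)
  have X_ge: "1 \<le> X x" if "0 \<le> x" for x
    using that t by (simp add: X_def)
  have X_nn: "0 \<le> X x" for x by (simp add: X_def)
  define R P A D where "R = X r" and "P = X p" and "A = X a" and "D = X d"
  obtain nr :: nat where nr: "R \<le> nr" "nr \<le> 2 * R"
    using X_ge assms(1) unfolding R_def by (blast intro: nat_approx)
  obtain np :: nat where np: "P \<le> np" "np \<le> 2 * P"
    using X_ge assms(2) unfolding P_def by (blast intro: nat_approx)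
  obtain nc :: nat where nc: "D \<le> nc" "nc \<le> 2 * D"
    using X_ge[of d] assms(2,3) unfolding D_def by (meson nat_approx order_trans)
  \<comment> \<open>The number of cliques has exponent \<open>a - d\<close>, so that all cliques
    together have about \<open>X a\<close> vertices.\<close>
  obtain nq :: nat where nq: "X (a - d) \<le> nq" "nq \<le> 2 * X (a - d)"
    using X_ge[of "a - d"] assms(4) by (meson nat_approx diff_ge_0_iff_ge)
  have A_eq: "A = X (a - d) * D"
    unfolding A_def D_def by (simp flip: X_add)
  have nn: "0 \<le> R" "0 \<le> P" "0 \<le> A" "0 \<le> D"
    by (simp_all add: R_def P_def A_def D_def X_nn)
  have q: "A \<le> real nq * real nc"
    unfolding A_eq using nq nc X_nn nn by (intro mult_mono) auto
  have "real nq * real nc \<le> (2 * X (a - d)) * (2 * D)"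
    using nq nc X_nn nn by (intro mult_mono) auto
  then have q': "real nq * real nc \<le> 4 * A"
    by (simp add: A_eq)
  have ge1: "1 \<le> P" "1 \<le> D"
    using assms X_ge by (auto simp: P_def D_def)
  have le: "P \<le> D" "D \<le> A"
    using assms X_mono by (auto simp: P_def D_def A_def)
  have "D\<^sup>2 \<le> P * A"
    using X_mono[OF assms(5)] X_mult[of 2 d] by (simp add: D_def P_def A_def X_add)
  note core = broom_sum_core_bounds[OF ge1(1) np q q' ge1(2) nc le this]
  obtain G where G: "is_graph G" "\<And>i. hom (Ugraph i) G = nr * hom (Ugraph i) (core np nq nc)"
    using disjoint_copies[OF is_graph_core] by blast
  have N0: "real (hom (Ugraph 0) G) = nr * (np + real nq * real nc)"
    by (simp add: G(2) hom_Ugraph[OF is_graph_core] verts_core)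
  have N: "real (hom (Ugraph (Suc k)) G) = nr * real (broom_sum (edges (core np nq nc)) k)" for k
    by (simp add: G(2) hom_Ugraph[OF is_graph_core])
  have Xh: "R * (P * A ^ Suc k * D) = X (r + p + real (Suc k) * a + d)" for k
    unfolding X_add X_mult R_def P_def A_def D_def by (simp only: mult.assoc)
  have Xc: "R * (P * A\<^sup>2 * D ^ k) = X (r + p + 2 * a + real k * d)" for k
  proof -
    have "X (2 * a) = (X a)\<^sup>2" using X_mult[of 2 a] by simp
    then show ?thesis
      unfolding X_add X_mult R_def P_def A_def D_def by (simp only: mult.assoc)
  qed
  show "\<exists>G. is_graph G \<and> (\<forall>i\<le>m. real (hom (Ugraph i) G) \<le> 192 * 4 ^ m * exp (t * y i))
      \<and> (\<forall>i\<in>I. exp (t * y i) \<le> real (hom (Ugraph i) G))"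
    using G(1)
  proof (intro exI[of _ G] conjI allI impI ballI)
    fix i assume "i \<le> m"
    show "real (hom (Ugraph i) G) \<le> 192 * 4 ^ m * exp (t * y i)"
    proof (cases i)
      case 0
      have "real (hom (Ugraph i) G) \<le> (2 * R) * (2 * A + 4 * A)"
      proof -
        have "np + real nq * real nc \<le> 2 * A + 4 * A"
          using np q' le by linarith
        then show ?thesis
          unfolding 0 N0 using nr nn by (intro mult_mono) auto
      qed
      also have "\<dots> = 12 * X (r + a)"
        by (simp add: X_add R_def A_def)
      also have "\<dots> \<le> (192 * 4 ^ m) * X (y 0)"
      proof -
        have "(1::real) \<le> 4 ^ m" by simp
        then have "(12::real) \<le> 192 * 4 ^ m" by linarith
        then show ?thesis
          using X_mono[OF y0] X_nn by (intro mult_mono) auto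
      qed
      finally show ?thesis by (simp add: 0 X_def)
    next
      case (Suc k)
      then have k: "k < m" using \<open>i \<le> m\<close> by simp
      have "real (hom (Ugraph i) G)
          \<le> (2 * R) * (32 * 4 ^ k * (P * A ^ Suc k * D) + 64 * 4 ^ k * (P * A\<^sup>2 * D ^ k))"
        unfolding Suc N using core(3) nr nn by (intro mult_mono) auto
      also have "\<dots> = 64 * 4 ^ k * (R * (P * A ^ Suc k * D)) + 128 * 4 ^ k * (R * (P * A\<^sup>2 * D ^ k))"
        by (simp add: algebra_simps)
      also have "\<dots> \<le> 64 * 4 ^ k * X (y i) + 128 * 4 ^ k * X (y i)"
        unfolding Xh Xc Suc using X_mono[OF hub[OF k]] X_mono[OF clique[OF k]]
        by (intro add_mono mult_left_mono) auto
      also have "\<dots> = 192 * 4 ^ k * X (y i)" by simp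
      also have "\<dots> \<le> 192 * 4 ^ m * X (y i)"
        using k X_nn by (intro mult_right_mono mult_left_mono power_increasing) auto
      finally show ?thesis by (simp add: X_def)
    qed
  next
    fix i assume "i \<in> I"
    then obtain k where k: "k < m" "i = Suc k"
      "y i = r + p + real (Suc k) * a + d \<or> y i = r + p + 2 * a + real k * d"
      using I by blast
    have "R * (P * A ^ Suc k * D) \<le> real (hom (Ugraph i) G)"
      "R * (P * A\<^sup>2 * D ^ k) \<le> real (hom (Ugraph i) G)"
      unfolding k(2) N using core(1,2) nr nn by (intro mult_mono; simp)+
    then show "exp (t * y i) \<le> real (hom (Ugraph i) G)"
      using k(3) unfolding Xh Xc by (auto simp: X_def)
  qed
qed

subsection \<open>Points of the cone are tropical limits\<close>

text \<open>Telescoping from \<open>i\<close> to \<open>j\<close> in either direction. Indices start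
  at 1 because \<open>y 0\<close> is not part of the convex sequence.\<close>

lemma convex_tangent:
  fixes y :: "nat \<Rightarrow> real"
  assumes i: "1 \<le> i" "i \<le> m" and j: "1 \<le> j" "j \<le> m"
    and left: "\<And>l. 1 \<le> l \<Longrightarrow> l < i \<Longrightarrow> y (Suc l) - y l \<le> a"
    and right: "\<And>l. i \<le> l \<Longrightarrow> l < m \<Longrightarrow> a \<le> y (Suc l) - y l"
  shows "y i + (real j - real i) * a \<le> y j"
proof (cases "i \<le> j")
  case True
  then show ?thesis
    using j(2)
  proof (induction j rule: dec_induct)
    case (step n)
    then show ?case using right[of n] by (simp add: algebra_simps)
  qed simp
next
  case False
  then have "j \<le> i" by simp
  then show ?thesis
    using j(1)
  proof (induction j rule: inc_induct)
    case (step n)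
    then show ?case using left[of n] by (simp add: algebra_simps)
  qed simp
qed

section \<open>Slopes and tangents of a point of the cone\<close>

locale Q_point =
  fixes m :: nat and y :: "nat \<Rightarrow> real"
  assumes m: "m \<ge> 4" and y: "y \<in> Qset m"
begin

definition s :: "nat \<Rightarrow> real" where "s i = y (Suc i) - y i"

text \<open>All facets except convexity. Those at the far end are written with
  \<open>s (m - 1)\<close>, the largest slope, which acts as the exponent of the maximum
  degree.\<close>

lemma facets:
  shows "y 1 \<le> y 2" "3 * y 2 \<le> 4 * y 1" "3 * y 3 \<le> 3 * y 1 + y 4"
    "2 * s (m - 1) \<le> y 1" "s (m - 1) \<le> y 0" "2 * y 1 \<le> y 0 + y 3"
    "real (m - 1) * s (m - 1) \<le> y (m - 1)"
proof -
  have m': "Suc (m - 1) = m" "real m = real (m - 1) + 1" using m by auto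
  show "y 1 \<le> y 2" "3 * y 2 \<le> 4 * y 1" "3 * y 3 \<le> 3 * y 1 + y 4"
    "2 * s (m - 1) \<le> y 1" "s (m - 1) \<le> y 0" "2 * y 1 \<le> y 0 + y 3"
    using y unfolding Qset_def s_def m'(1) by auto
  have "real m * y (m-1) - real (m-1) * y m \<ge> 0"
    using y unfolding Qset_def by auto
  then show "real (m - 1) * s (m - 1) \<le> y (m - 1)"
    unfolding s_def m'(1) m'(2) by (simp add: algebra_simps)
qed

lemma slope_mono:
  assumes "1 \<le> i" "i \<le> j" "j < m"
  shows "s i \<le> s j"
  using assms(2,3)
proof (induction j rule: dec_induct)
  case (step n)
  then have "2 \<le> Suc n \<and> Suc n \<le> m - 1" using assms(1) by auto
  then have "y (Suc n - 1) - 2 * y (Suc n) + y (Suc n + 1) \<ge> 0"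
    using y unfolding Qset_def by blast
  with step show ?case by (simp add: s_def)
qed simp

text \<open>Any slope between the two one-sided slopes at \<open>i\<close> is allowed; the
  alternatives \<open>i = 1\<close> and \<open>i = m\<close> drop the side that does not
  exist.\<close>

lemma tangent:
  assumes "1 \<le> i" "i \<le> m" "1 \<le> j" "j \<le> m" "i = 1 \<or> s (i - 1) \<le> a" "i = m \<or> a \<le> s i"
  shows "y i + (real j - real i) * a \<le> y j"
proof (rule convex_tangent[OF assms(1-4)])
  show "y (Suc l) - y l \<le> a" if "1 \<le> l" "l < i" for l
  proof -
    have "s l \<le> s (i - 1)"
      by (rule slope_mono) (use that assms(2) in auto)
    then show ?thesis using that assms(5) by (auto simp: s_def)
  qed
  show "a \<le> y (Suc l) - y l" if "i \<le> l" "l < m" for l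
  proof -
    have "s i \<le> s l"
      by (rule slope_mono) (use that assms(1) in auto)
    then show ?thesis using that assms(6) by (auto simp: s_def)
  qed
qed

lemma y_slopes: "y 2 = y 1 + s 1" "y 3 = y 1 + s 1 + s 2" "y 4 = y 3 + s 3"
  by (simp_all add: s_def eval_nat_numeral)

lemma s_nonneg: "1 \<le> i \<Longrightarrow> i < m \<Longrightarrow> 0 \<le> s i"
  using slope_mono[of 1 i] facets(1) y_slopes by simp

lemma achieves_1_2: "achieves m y {1, 2}"
proof -
  \<comment> \<open>Cliques follow the line of slope \<open>s 1\<close> through \<open>y 1\<close> and \<open>y 2\<close>, hubs a tangent at \<open>y 2\<close>
    whose slope is kept small enough for the number of copies to be at least one.\<close>
  define a where "a = min (s 2) ((y 1 - s 1) / 2)"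
  have s: "0 \<le> s 1" "s 1 \<le> s 2" "s 2 \<le> s (m - 1)"
    using m s_nonneg[of 1] slope_mono[of 1 2] slope_mono[of 2 "m - 1"] by auto
  have "a \<le> (y 1 - s 1) / 2" by (simp only: a_def min.cobounded2)
  then have a3: "2 * a \<le> y 1 - s 1" by (simp only: le_divide_eq_numeral1 mult.commute)
  \<comment> \<open>The facet \<open>3 * y 2 \<le> 4 * y 1\<close> says
    \<open>3 * s 1 \<le> y 1\<close>, hence \<open>s 1 \<le> (y 1 - s 1) / 2\<close>.\<close>
  have a: "s 1 \<le> a" "a \<le> s 2"
    using s facets(2) y_slopes by (auto simp: a_def)
  show ?thesis
  \<comment> \<open>The hub exponents become \<open>y 2 + (k - 1) * a\<close> and the clique
    exponents \<open>y 1 + k * s 1\<close>.\<close>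
  proof (rule achieves_core[where r = "y 1 - 2 * a - s 1" and p = "s 1" and d = "s 1" and a = a])
    show "y 1 - 2 * a - s 1 + a \<le> y 0"
    proof (cases "s 2 \<le> (y 1 - s 1) / 2")
      case True
      then have "a = s 2" by (simp add: a_def)
      then show ?thesis using facets(6) y_slopes by linarith
    next
      case False
      then have "a = (y 1 - s 1) / 2" by (simp add: a_def)
      then have "2 * a = y 1 - s 1" by (simp only: eq_divide_eq_numeral1 mult.commute)
      then show ?thesis using facets(5) s a(2) by linarith
    qed
    fix k assume k: "k < m"
    show "y 1 - 2 * a - s 1 + s 1 + real (Suc k) * a + s 1 \<le> y (Suc k)"
      using tangent[of 2 "Suc k" a] k m a y_slopes by (simp add: algebra_simps)
    show "y 1 - 2 * a - s 1 + s 1 + 2 * a + real k * s 1 \<le> y (Suc k)"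
      using tangent[of 1 "Suc k" "s 1"] k m by (simp add: algebra_simps)
  next
    fix i :: nat assume "i \<in> {1, 2}"
    then show "\<exists>k<m. i = Suc k \<and> (y i = y 1 - 2 * a - s 1 + s 1 + real (Suc k) * a + s 1
        \<or> y i = y 1 - 2 * a - s 1 + s 1 + 2 * a + real k * s 1)"
      using m y_slopes by (intro exI[of _ "i - 1"]) auto
  qed (use s a a3 in auto)
qed

text \<open>The line through the points at \<open>i\<close> and \<open>Suc i\<close> lies below the
  convex sequence; \<open>b\<close> is its value at index 1. If \<open>3 * a \<le> b\<close>, equal
  exponents \<open>p = d = a\<close> put hubs and cliques both on the line and copies supply the
  rest; otherwise one copy suffices, with only the hubs required to reach the line.\<close>

lemma achieves_tangent_edge:
  assumes i: "3 \<le> i" "i < m"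
  shows "achieves m y {i, Suc i}"
proof -
  define a where "a = s i"
  define b where "b = y i - (real i - 1) * a"
  have line: "b + real k * a \<le> y (Suc k)" if "k < m" for k
    using tangent[of i "Suc k" a] slope_mono[of "i - 1" i] that i
    by (simp add: a_def b_def algebra_simps)
  have on_line: "y (Suc k) = b + real k * a" if "Suc k = i \<or> k = i" for k
    using that by (auto simp: b_def a_def s_def algebra_simps)
  have a: "a \<le> s (m - 1)" "s 3 \<le> a" "s 2 \<le> a" "s 1 \<le> a" "0 \<le> a"
    using i s_nonneg[of i] slope_mono[of i "m - 1"] slope_mono[of 3 i] slope_mono[of 2 i] slope_mono[of 1 i]
    by (auto simp: a_def)
  \<comment> \<open>By the last facet, the tangent of slope \<open>s (m - 1)\<close> at
    \<open>m - 1\<close> is nonnegative at index 0, so it dominates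
    \<open>real i * s (m - 1)\<close>.\<close>
  have "real i * a \<le> y i"
  proof -
    have "y (m - 1) + (real i - real (m - 1)) * s (m - 1) \<le> y i"
      using tangent[of "m - 1" i "s (m - 1)"] slope_mono[of "m - 2" "m - 1"] m i
      by (simp add: numeral_2_eq_2)
    then have "real i * s (m - 1) \<le> y i"
      using facets(7) by (simp add: algebra_simps)
    then show ?thesis
      using mult_left_mono[OF a(1), of "real i"] by simp
  qed
  then have "a \<le> b" by (simp add: b_def algebra_simps)
  have "2 * a \<le> y 1" using a(1) facets(4) by simp
  have b2: "b + 2 * a \<le> y 3" using line[of 2] m by (simp add: eval_nat_numeral)
  \<comment> \<open>From \<open>y 4 = y 3 + s 3\<close> the facet gives
    \<open>2 * y 3 \<le> 3 * y 1 + s 3\<close>, and \<open>s 3 \<le> a\<close>. The result says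
    \<open>b + a - y 1 \<le> b / 3\<close>.\<close>
  have b3: "2 * b + 3 * a \<le> 3 * y 1" using b2 a(2) facets(3) y_slopes by simp
  have eq: "\<exists>k<m. j = Suc k \<and> y j = b + real k * a" if "j \<in> {i, Suc i}" for j
  proof -
    have "Suc (j - 1) = j" "j - 1 < m" using that i by auto
    then show ?thesis
      using that on_line[of "j - 1"] by (intro exI[of _ "j - 1"]) auto
  qed
  show ?thesis
  proof (cases "3 * a \<le> b")
    case True
    show ?thesis
    proof (rule achieves_core[where r = "b - 3 * a" and p = a and d = a and a = a])
      \<comment> \<open>Here \<open>y 0\<close> is at least \<open>y 1 - s 1 - s 2\<close> and
        \<open>b + 2 * a\<close> at most \<open>y 1 + s 1 + s 2\<close>, with both slopes at most
        \<open>a\<close>.\<close>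
      show "b - 3 * a + a \<le> y 0"
        using b2 facets(6) y_slopes a by simp
      show "\<exists>k<m. j = Suc k \<and> (y j = b - 3 * a + a + real (Suc k) * a + a
          \<or> y j = b - 3 * a + a + 2 * a + real k * a)" if "j \<in> {i, Suc i}" for j
      proof -
        have "b - 3 * a + a + real (Suc k) * a + a = b + real k * a" for k
          by (simp add: algebra_simps)
        then show ?thesis using eq[OF that] by metis
      qed
    qed (use True a line in \<open>auto simp: algebra_simps\<close>)
  next
    case False
    \<comment> \<open>The hubs lie on the tangent line for any \<open>d\<close> with \<open>p = b - a - d\<close>; the maximum is the least
      \<open>d\<close> for which \<open>p \<le> d\<close> and the cliques stay below \<open>y 1\<close>, and it is at most \<open>b / 3\<close> because of
      \<open>3 * y 3 \<le> 3 * y 1 + y 4\<close>.\<close>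
    define d where "d = max ((b - a) / 2) (b + a - y 1)"
    have "(b - a) / 2 \<le> d" and d2: "b + a - y 1 \<le> d" and "d = (b - a) / 2 \<or> d = b + a - y 1"
      by (auto simp: d_def max_def)
    \<comment> \<open>For \<open>p = b - a - d\<close> these are \<open>p \<le> d\<close>,
      \<open>2 * d \<le> p + a\<close> and \<open>0 \<le> p\<close>.\<close>
    then have d: "b - a \<le> 2 * d" "3 * d \<le> b" "d \<le> b - a"
      using \<open>a \<le> b\<close> \<open>2 * a \<le> y 1\<close> b3 False by (simp_all, auto)
    show ?thesis
    proof (rule achieves_core[where r = 0 and p = "b - a - d" and d = d and a = a])
      show "0 + a \<le> y 0" using a(1) facets(5) by simp
      fix k assume k: "k < m"
      show "0 + (b - a - d) + real (Suc k) * a + d \<le> y (Suc k)"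
        using line[OF k] by (simp add: algebra_simps)
      show "0 + (b - a - d) + 2 * a + real k * d \<le> y (Suc k)"
      \<comment> \<open>The clique exponent is on the line at \<open>k = 1\<close> and grows with
        slope \<open>d \<le> a\<close> afterwards; only \<open>k = 0\<close> uses the bound by
        \<open>y 1\<close>.\<close>
      proof (cases k)
        case 0
        then show ?thesis using d2 by simp
      next
        case (Suc l)
        have "real l * d \<le> real l * a"
          using d False by (intro mult_left_mono) auto
        then show ?thesis
          using line[OF k] by (simp add: Suc algebra_simps)
      qed
    next
      show "\<exists>k<m. j = Suc k \<and> (y j = 0 + (b - a - d) + real (Suc k) * a + d
          \<or> y j = 0 + (b - a - d) + 2 * a + real k * d)" if "j \<in> {i, Suc i}" for j
      proof -
        have "0 + (b - a - d) + real (Suc k) * a + d = b + real k * a" for k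
          by (simp add: algebra_simps)
        then show ?thesis using eq[OF that] by metis
      qed
    qed (use d False in auto)
  qed
qed

lemma mem_trop_profile: "y \<in> trop_profile m"
proof (rule achieves_imp_trop)
  show "\<forall>i>m. y i = 0"
    using y by (simp add: Qset_def)
  have "achieves m y {i}" if "i \<le> m" for i
  proof -
    consider "i = 0" | "i = 1 \<or> i = 2" | "3 \<le> i" "i < m" | "i = m"
      using \<open>i \<le> m\<close> by linarith
    then show ?thesis
    proof cases
      case 1
      have "0 \<le> s (m - 1)"
        by (rule s_nonneg) (use m in auto)
      then have "0 \<le> y 0" using facets(5) by linarith
      then show ?thesis using achieves_vertices 1 by simp
    next
      case 2
      then show ?thesis by (intro achieves_subset[OF achieves_1_2]) auto
    next
      case 3
      then show ?thesis by (intro achieves_subset[OF achieves_tangent_edge[of i]]) auto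
    next
      case 4
      \<comment> \<open>The last coordinate is the right end of the edge at \<open>m - 1\<close>,
        which is at least 3.\<close>
      then show ?thesis
        using m by (intro achieves_subset[OF achieves_tangent_edge[of "m - 1"]]) auto
    qed
  qed
  then show "achieves m y {..m}"
    using achieves_pointwise[OF finite_atMost] by simp
qed

end

theorem theorem1p2:
  fixes m :: nat
  assumes "m \<ge> 4"
  shows "trop_profile m = Qset m"
proof
  show "trop_profile m \<subseteq> Qset m"
    by (rule trop_profile_subset_Qset[OF assms])
  show "Qset m \<subseteq> trop_profile m"
    using Q_point.mem_trop_profile Q_point.intro[OF assms] by blast
qed

end
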